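(* Each congruence on the semiring $\mathbb{N}$ of natural numbers is generated by one element, i.e. for every congruence $\rho$ on $\mathbb N$ there is a pair $(n,m)\in\mathbb N\times\mathbb N$ such that $\rho$ is the smallest congruence containing $(n,m)$. In particular, $\mathbb{N}$ is Noetherian.
   Context: $\mathbb N$ is the semiring of natural numbers (including $0$) with usual addition and multiplication. A congruence on a semiring is an equivalence relation compatible with both operations. A semiring is Noetherian if it satisfies the ascending chain condition on congruences. *)

theory Defs
  imports Main
begin

definition semiring_congruence :: "('a::semiring) rel \<Rightarrow> bool" where
  "semiring_congruence \<rho> \<longleftrightarrow>
     equiv UNIV \<rho> \<and>
     (\<forall>a b c d. (a, b) \<in> \<rho> \<longrightarrow> (c, d) \<in> \<rho> \<longrightarrow>
        (a + c, b + d) \<in> \<rho> \<and> (a * c, b * d) \<in> \<rho>)"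

definition smallest_congruence_containing :: "('a::semiring) rel \<Rightarrow> 'a \<times> 'a \<Rightarrow> bool" where
  "smallest_congruence_containing \<rho> p \<longleftrightarrow>
     semiring_congruence \<rho> \<and> p \<in> \<rho> \<and>
     (\<forall>\<sigma>. semiring_congruence \<sigma> \<longrightarrow> p \<in> \<sigma> \<longrightarrow> \<rho> \<subseteq> \<sigma>)"

definition noetherian_semiring :: "('a::semiring) itself \<Rightarrow> bool" where
  "noetherian_semiring _ \<longleftrightarrow>
     (\<forall>C :: nat \<Rightarrow> 'a rel.
        (\<forall>i. semiring_congruence (C i)) \<longrightarrow> (\<forall>i. C i \<subseteq> C (Suc i)) \<longrightarrow>
        (\<exists>N. \<forall>i\<ge>N. C i = C N))"

end

theory Submission
  imports Defs
begin

text \<open>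
  Already as a congruence of the cyclic monoid \<open>(\<nat>, +)\<close>, a nontrivial congruence \<open>\<rho>\<close> is determined
  by two numbers: the least \<open>n\<close> that is related to some larger number, and the least period \<open>d > 0\<close>
  with \<open>n\<close> related to \<open>n + d\<close>. Two distinct numbers are then related exactly when both are at least
  \<open>n\<close> and their difference is a multiple of \<open>d\<close>. The argument
  that \<open>d\<close> divides the difference is division with remainder (\<open>minimal_period_dvd_gap\<close>): a remainder
  would be a shorter period at \<open>n\<close>. Conversely, every congruence containing \<open>(n, n + d)\<close> relates
  such numbers, by shifting and iterating this one pair (\<open>congruence_iterate_period\<close>). Hence
  \<open>(n, n + d)\<close> generates \<open>\<rho>\<close>. The equality relation is generated by \<open>(0, 0)\<close>.

  The chain condition follows as for ideals: the union of an ascending chain of congruences is a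
  congruence, its single generator occurs at some stage, and from there on the chain is constant
  (\<open>noetherian_if_principal\<close>).
\<close>

lemma semiring_congruenceD:
  assumes "semiring_congruence \<rho>"
  shows semiring_congruence_refl: "(a, a) \<in> \<rho>"
    and semiring_congruence_sym: "(a, b) \<in> \<rho> \<Longrightarrow> (b, a) \<in> \<rho>"
    and semiring_congruence_trans: "(a, b) \<in> \<rho> \<Longrightarrow> (b, c) \<in> \<rho> \<Longrightarrow> (a, c) \<in> \<rho>"
    and semiring_congruence_add: "(a, b) \<in> \<rho> \<Longrightarrow> (c, d) \<in> \<rho> \<Longrightarrow> (a + c, b + d) \<in> \<rho>"
    and semiring_congruence_mult: "(a, b) \<in> \<rho> \<Longrightarrow> (c, d) \<in> \<rho> \<Longrightarrow> (a * c, b * d) \<in> \<rho>"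
proof -
  have equiv: "refl \<rho>" "sym \<rho>" "trans \<rho>"
    using assms by (simp_all add: semiring_congruence_def equiv_def)
  show "(a, a) \<in> \<rho>" using equiv(1) by (simp add: refl_on_def)
  show "(a, b) \<in> \<rho> \<Longrightarrow> (b, a) \<in> \<rho>" by (rule symD[OF equiv(2)])
  show "(a, b) \<in> \<rho> \<Longrightarrow> (b, c) \<in> \<rho> \<Longrightarrow> (a, c) \<in> \<rho>" by (rule transD[OF equiv(3)])
  show "(a, b) \<in> \<rho> \<Longrightarrow> (c, d) \<in> \<rho> \<Longrightarrow> (a + c, b + d) \<in> \<rho>"
    using assms by (simp add: semiring_congruence_def)
  show "(a, b) \<in> \<rho> \<Longrightarrow> (c, d) \<in> \<rho> \<Longrightarrow> (a * c, b * d) \<in> \<rho>"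
    using assms by (simp add: semiring_congruence_def)
qed

lemma congruence_iterate_period:
  fixes n d :: nat
  assumes \<rho>: "semiring_congruence \<rho>" and "(n, n + d) \<in> \<rho>" and "n \<le> a"
  shows "(a, a + q * d) \<in> \<rho>"
proof (induction q)
  case 0
  show ?case by (simp add: semiring_congruence_refl[OF \<rho>])
next
  case (Suc q)
  have "(n + (a - n + q * d), n + d + (a - n + q * d)) \<in> \<rho>"
    by (rule semiring_congruence_add[OF \<rho> assms(2) semiring_congruence_refl[OF \<rho>]])
  with \<open>n \<le> a\<close> have "(a + q * d, a + Suc q * d) \<in> \<rho>" by (simp add: algebra_simps)
  with Suc.IH show ?case by (rule semiring_congruence_trans[OF \<rho>])
qed

text \<open>
  The pair \<open>(a, a + e)\<close> can be transported down to \<open>n\<close>: moving it up to a point \<open>n + t * d\<close>, which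
  is related to \<open>n\<close>, shows that \<open>e\<close> is a period at \<open>n\<close> as well, and then so is \<open>e mod d\<close>.
\<close>

lemma minimal_period_dvd_gap:
  fixes n d a e :: nat
  assumes \<rho>: "semiring_congruence \<rho>" and "d > 0" and period: "(n, n + d) \<in> \<rho>"
    and minimal: "\<And>r. 0 < r \<Longrightarrow> r < d \<Longrightarrow> (n, n + r) \<notin> \<rho>"
    and "n \<le> a" and gap: "(a, a + e) \<in> \<rho>"
  shows "d dvd e"
proof -
  \<comment> \<open>Any multiple of \<open>d\<close> that is at least \<open>a - n\<close> would do.\<close>
  define t where "t = a - n"
  have "t \<le> t * d" using \<open>d > 0\<close> by simp
  then have top: "a + (t * d - t) = n + t * d" using \<open>n \<le> a\<close> t_def by linarith
  have "(a + (t * d - t), a + e + (t * d - t)) \<in> \<rho>"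
    by (rule semiring_congruence_add[OF \<rho> gap semiring_congruence_refl[OF \<rho>]])
  moreover have "a + e + (t * d - t) = n + e + t * d" using top by linarith
  ultimately have "(n + t * d, n + e + t * d) \<in> \<rho>" using top by simp
  moreover have "(n, n + t * d) \<in> \<rho>"
    by (rule congruence_iterate_period[OF \<rho> period]) simp
  moreover have "(n + e, n + e + t * d) \<in> \<rho>"
    by (rule congruence_iterate_period[OF \<rho> period]) simp
  ultimately have "(n, n + e) \<in> \<rho>"
    by (meson \<rho> semiring_congruence_sym semiring_congruence_trans)
  moreover have "(n + e mod d, n + e) \<in> \<rho>"
    using congruence_iterate_period[OF \<rho> period, of "n + e mod d" "e div d"]
    by (simp add: add.assoc)
  ultimately have "(n, n + e mod d) \<in> \<rho>"
    by (meson \<rho> semiring_congruence_sym semiring_congruence_trans)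
  with minimal \<open>d > 0\<close> have "e mod d = 0" by (metis mod_less_divisor neq0_conv)
  then show ?thesis by (simp add: dvd_eq_mod_eq_0)
qed

text \<open>By symmetry, only the pairs \<open>(a, b)\<close> with \<open>a < b\<close> carry information.\<close>

lemma congruence_subset_if_increasing_pairs:
  fixes \<rho> \<sigma> :: "nat rel"
  assumes \<rho>: "semiring_congruence \<rho>" and \<sigma>: "semiring_congruence \<sigma>"
    and less: "\<And>a b. a < b \<Longrightarrow> (a, b) \<in> \<rho> \<Longrightarrow> (a, b) \<in> \<sigma>"
  shows "\<rho> \<subseteq> \<sigma>"
proof (rule subrelI)
  fix a b assume ab: "(a, b) \<in> \<rho>"
  show "(a, b) \<in> \<sigma>"
  proof (cases a b rule: linorder_cases)
    case greater
    with ab show ?thesis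
      using less semiring_congruence_sym[OF \<rho>] semiring_congruence_sym[OF \<sigma>] by blast
  qed (use ab less semiring_congruence_refl[OF \<sigma>] in auto)
qed

lemma nat_congruence_principal:
  fixes \<rho> :: "nat rel"
  assumes \<rho>: "semiring_congruence \<rho>"
  shows "\<exists>n m. smallest_congruence_containing \<rho> (n, m)"
proof (cases "\<exists>n m. n < m \<and> (n, m) \<in> \<rho>")
  case False
  then have "smallest_congruence_containing \<rho> (0, 0)"
    using \<rho> semiring_congruence_refl[OF \<rho>] congruence_subset_if_increasing_pairs[OF \<rho>]
    by (auto simp: smallest_congruence_containing_def)
  then show ?thesis by blast
next
  case True
  define n where "n = (LEAST n. \<exists>m>n. (n, m) \<in> \<rho>)"
  have "\<exists>m>n. (n, m) \<in> \<rho>" unfolding n_def by (rule LeastI_ex) (use True in blast)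
  then obtain m where "n < m" "(n, m) \<in> \<rho>" by blast
  then have period_ex: "\<exists>d. d > 0 \<and> (n, n + d) \<in> \<rho>"
    by (intro exI[of _ "m - n"]) simp
  have index: "n \<le> a" if "a < b" "(a, b) \<in> \<rho>" for a b
    unfolding n_def by (rule Least_le) (use that in blast)
  define d where "d = (LEAST d. d > 0 \<and> (n, n + d) \<in> \<rho>)"
  have d: "d > 0" "(n, n + d) \<in> \<rho>" using LeastI_ex[OF period_ex] by (simp_all add: d_def)
  have minimal: "(n, n + r) \<notin> \<rho>" if "0 < r" "r < d" for r
    using not_less_Least[of r "\<lambda>d. d > 0 \<and> (n, n + d) \<in> \<rho>"] that by (simp add: d_def)
  have "\<rho> \<subseteq> \<sigma>" if \<sigma>: "semiring_congruence \<sigma>" and gen: "(n, n + d) \<in> \<sigma>" for \<sigma>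
  proof (rule congruence_subset_if_increasing_pairs[OF \<rho> \<sigma>])
    fix a b assume ab: "a < b" "(a, b) \<in> \<rho>"
    then have "d dvd b - a"
      using minimal_period_dvd_gap[OF \<rho> d minimal index[OF ab], of "b - a"] by simp
    then obtain q where "b - a = q * d" by (metis dvdE mult.commute)
    then have "b = a + q * d" using ab(1) by linarith
    then show "(a, b) \<in> \<sigma>"
      using congruence_iterate_period[OF \<sigma> gen index[OF ab]] by simp
  qed
  with \<rho> d have "smallest_congruence_containing \<rho> (n, n + d)"
    by (auto simp: smallest_congruence_containing_def)
  then show ?thesis by blast
qed

text \<open>
  Each congruence axiom has at most two pairs as premises, and two pairs of the union lie in a
  common member of the chain.
\<close>

lemma semiring_congruence_Union_chain:
  fixes C :: "nat \<Rightarrow> ('a::semiring) rel"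
  assumes C: "\<And>i. semiring_congruence (C i)" and "mono C"
  shows "semiring_congruence (\<Union>i. C i)"
proof -
  have common: "\<exists>k. p \<in> C k \<and> q \<in> C k" if "p \<in> (\<Union>i. C i)" "q \<in> (\<Union>i. C i)" for p q
  proof -
    from that obtain i j where "p \<in> C i" "q \<in> C j" by blast
    then have "p \<in> C (max i j) \<and> q \<in> C (max i j)"
      using monoD[OF \<open>mono C\<close>, of i "max i j"] monoD[OF \<open>mono C\<close>, of j "max i j"] by auto
    then show ?thesis ..
  qed
  have "equiv UNIV (\<Union>i. C i)"
  proof (rule equivI)
    show "refl (\<Union>i. C i)" using semiring_congruence_refl[OF C] by (auto intro: refl_onI)
    show "sym (\<Union>i. C i)" using semiring_congruence_sym[OF C] by (blast intro: symI)
    show "trans (\<Union>i. C i)"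
    proof (rule transI)
      fix x y z assume "(x, y) \<in> (\<Union>i. C i)" "(y, z) \<in> (\<Union>i. C i)"
      from common[OF this] obtain k where "(x, y) \<in> C k" "(y, z) \<in> C k" by blast
      then have "(x, z) \<in> C k" by (rule semiring_congruence_trans[OF C])
      then show "(x, z) \<in> (\<Union>i. C i)" by blast
    qed
  qed simp
  moreover have "(a + c, b + d) \<in> (\<Union>i. C i) \<and> (a * c, b * d) \<in> (\<Union>i. C i)"
    if "(a, b) \<in> (\<Union>i. C i)" "(c, d) \<in> (\<Union>i. C i)" for a b c d
  proof -
    from common[OF that] obtain k where k: "(a, b) \<in> C k" "(c, d) \<in> C k" by blast
    show ?thesis
      using semiring_congruence_add[OF C k] semiring_congruence_mult[OF C k] by blast
  qed
  ultimately show ?thesis by (simp add: semiring_congruence_def)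
qed

lemma noetherian_if_principal:
  assumes principal: "\<And>\<rho> :: ('a::semiring) rel. semiring_congruence \<rho> \<Longrightarrow>
    \<exists>n m. smallest_congruence_containing \<rho> (n, m)"
  shows "noetherian_semiring TYPE('a)"
  unfolding noetherian_semiring_def
proof (intro allI impI)
  fix C :: "nat \<Rightarrow> 'a rel"
  assume C: "\<forall>i. semiring_congruence (C i)" and "\<forall>i. C i \<subseteq> C (Suc i)"
  then have "mono C" by (simp add: mono_iff_le_Suc)
  with C obtain n m where gen: "smallest_congruence_containing (\<Union>i. C i) (n, m)"
    using principal[OF semiring_congruence_Union_chain[of C]] by blast
  then obtain N where "(n, m) \<in> C N" by (auto simp: smallest_congruence_containing_def)
  with gen C have "(\<Union>i. C i) \<subseteq> C N" by (simp add: smallest_congruence_containing_def)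
  with \<open>mono C\<close> have "\<forall>i\<ge>N. C i = C N" by (blast dest: monoD)
  then show "\<exists>N. \<forall>i\<ge>N. C i = C N" ..
qed

theorem corollary5p8:
  shows "(\<forall>\<rho> :: nat rel. semiring_congruence \<rho> \<longrightarrow>
            (\<exists>n m :: nat. smallest_congruence_containing \<rho> (n, m)))
         \<and> noetherian_semiring TYPE(nat)"
  using nat_congruence_principal noetherian_if_principal[OF nat_congruence_principal] by blast

end
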